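(* Let $R$ be a commutative ring, let $V,W$ be free $R$-modules of rank two with fixed bases, let $\alpha,\gamma,\delta\in R$, put $C=\begin{pmatrix}0&\gamma\\1&\delta-\alpha\end{pmatrix}$, and let $F:V\to W$ be an isomorphism. As $x$ varies over the admissible vectors for $T_F$, the set of graph maps is exactly the translated orbit: $$\{G_{L_x}: x\in V\oplus W\text{ admissible for }T_F\}=F\operatorname{Orb}(C)=\{FK:K\in\operatorname{Orb}(C)\},$$ where linear maps are identified with their matrices in the fixed bases. Consequently, if $2\in R^\times$, the complete family of transverse graph modules $\{L_x : x\text{ admissible for }T_F\}$ determines precisely the class $F\,\Gamma_C(R)$; that is, for isomorphisms $F,F':V\to W$ (with the same $\alpha,\gamma,\delta$), the families of transverse graph modules attached to $T_F$ and $T_{F'}$ coincide if and only if $F\,\Gamma_C(R)=F'\,\Gamma_C(R)$.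
   Context: The operator $T_F\in\operatorname{End}_R(V\oplus W)$ is $$T_F=\begin{pmatrix}\alpha I_V&F^{-1}\\ \gamma F&\delta I_W\end{pmatrix}.$$ For $x\in V\oplus W$, $L_x:=\langle x,T_Fx\rangle_R\subseteq V\oplus W$ is the submodule generated by $x$ and $T_Fx$. Let $\pi_V,\pi_W$ be the projections of $V\oplus W$ onto $V$ and $W$. A submodule $L\subseteq V\oplus W$ is $V$-transverse if $\pi_V|_L:L\to V$ is an isomorphism; in that case its graph map is $G_L=\pi_W|_L\circ(\pi_V|_L)^{-1}:V\to W$. A vector $x$ is admissible for $T_F$ if $L_x$ is $V$-transverse. $\operatorname{Orb}(C)=\{PCP^{-1}:P\in\operatorname{GL}_2(R)\}$ and $\Gamma_C(R)=\{H\in\operatorname{GL}_2(R):H\operatorname{Orb}(C)=\operatorname{Orb}(C)\}$. *)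

theory Defs
  imports "HOL-Analysis.Analysis"
begin

text \<open>
  Modules over a commutative ring \<open>'a\<close> are given by their scalar multiplication, as in the
  library's locale \<^locale>\<open>module\<close>; the carrier is the whole type.  The direct sum of two modules
  is the product type with the scalar multiplication \<^const>\<open>module_prod.scale\<close>.
\<close>

definition indexed_basis :: "('a::comm_ring_1 \<Rightarrow> 'v::ab_group_add \<Rightarrow> 'v) \<Rightarrow> ('n::finite \<Rightarrow> 'v) \<Rightarrow> bool"
  where "indexed_basis s b \<longleftrightarrow>
    module s \<and> inj b \<and> \<not> module.dependent s (range b) \<and> module.span s (range b) = UNIV"

definition module_isomorphism ::
  "('a::comm_ring_1 \<Rightarrow> 'v::ab_group_add \<Rightarrow> 'v) \<Rightarrow> ('a \<Rightarrow> 'w::ab_group_add \<Rightarrow> 'w) \<Rightarrow> ('v \<Rightarrow> 'w) \<Rightarrow> bool"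
  where "module_isomorphism s t f \<longleftrightarrow> module_hom s t f \<and> bij f"

text \<open>Column \<open>j\<close> of the matrix holds the coordinates of the image of the \<open>j\<close>-th basis vector.\<close>

definition matrix_wrt ::
  "('n::finite \<Rightarrow> 'v) \<Rightarrow> ('a::comm_ring_1 \<Rightarrow> 'w::ab_group_add \<Rightarrow> 'w) \<Rightarrow> ('m::finite \<Rightarrow> 'w)
    \<Rightarrow> ('v \<Rightarrow> 'w) \<Rightarrow> 'a ^ 'n ^ 'm"
  where "matrix_wrt b t c f = (\<chi> i j. module.representation t (range c) (f (b j)) (c i))"

definition T_op ::
  "('a::comm_ring_1 \<Rightarrow> 'v::ab_group_add \<Rightarrow> 'v) \<Rightarrow> ('a \<Rightarrow> 'w::ab_group_add \<Rightarrow> 'w) \<Rightarrow> 'a \<Rightarrow> 'a \<Rightarrow> 'a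
    \<Rightarrow> ('v \<Rightarrow> 'w) \<Rightarrow> 'v \<times> 'w \<Rightarrow> 'v \<times> 'w"
  where "T_op s t \<alpha> \<gamma> \<delta> F = (\<lambda>(v, w). (s \<alpha> v + inv F w, t \<gamma> (F v) + t \<delta> w))"

definition L_sub ::
  "('a::comm_ring_1 \<Rightarrow> 'v::ab_group_add \<Rightarrow> 'v) \<Rightarrow> ('a \<Rightarrow> 'w::ab_group_add \<Rightarrow> 'w) \<Rightarrow> 'a \<Rightarrow> 'a \<Rightarrow> 'a
    \<Rightarrow> ('v \<Rightarrow> 'w) \<Rightarrow> 'v \<times> 'w \<Rightarrow> ('v \<times> 'w) set"
  where "L_sub s t \<alpha> \<gamma> \<delta> F x = module.span (module_prod.scale s t) {x, T_op s t \<alpha> \<gamma> \<delta> F x}"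

text \<open>The projection is linear, so its restriction to a submodule is an isomorphism
  as soon as it is bijective.\<close>

definition V_transverse ::
  "('a::comm_ring_1 \<Rightarrow> 'v::ab_group_add \<Rightarrow> 'v) \<Rightarrow> ('a \<Rightarrow> 'w::ab_group_add \<Rightarrow> 'w) \<Rightarrow> ('v \<times> 'w) set \<Rightarrow> bool"
  where "V_transverse s t L \<longleftrightarrow>
    module.subspace (module_prod.scale s t) L \<and> bij_betw fst L UNIV"

definition graph_map :: "('v \<times> 'w) set \<Rightarrow> 'v \<Rightarrow> 'w"
  where "graph_map L = snd \<circ> inv_into L fst"

definition admissible ::
  "('a::comm_ring_1 \<Rightarrow> 'v::ab_group_add \<Rightarrow> 'v) \<Rightarrow> ('a \<Rightarrow> 'w::ab_group_add \<Rightarrow> 'w) \<Rightarrow> 'a \<Rightarrow> 'a \<Rightarrow> 'a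
    \<Rightarrow> ('v \<Rightarrow> 'w) \<Rightarrow> 'v \<times> 'w \<Rightarrow> bool"
  where "admissible s t \<alpha> \<gamma> \<delta> F x \<longleftrightarrow> V_transverse s t (L_sub s t \<alpha> \<gamma> \<delta> F x)"

definition C_mat :: "'a::comm_ring_1 \<Rightarrow> 'a \<Rightarrow> 'a \<Rightarrow> 'a ^ 2 ^ 2"
  where "C_mat \<alpha> \<gamma> \<delta> = vector [vector [0, \<gamma>], vector [1, \<delta> - \<alpha>]]"

definition GL2 :: "('a::comm_ring_1 ^ 2 ^ 2) set"
  where "GL2 = {P. invertible P}"

definition Orb :: "'a::comm_ring_1 ^ 2 ^ 2 \<Rightarrow> ('a ^ 2 ^ 2) set"
  where "Orb C = {P ** C ** matrix_inv P | P. P \<in> GL2}"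

definition translate :: "'a::comm_ring_1 ^ 2 ^ 2 \<Rightarrow> ('a ^ 2 ^ 2) set \<Rightarrow> ('a ^ 2 ^ 2) set"
  where "translate M S = {M ** K | K. K \<in> S}"

definition Gamma_stab :: "'a::comm_ring_1 ^ 2 ^ 2 \<Rightarrow> ('a ^ 2 ^ 2) set"
  where "Gamma_stab C = {H \<in> GL2. translate H (Orb C) = Orb C}"

end

theory Submission
  imports Defs
begin

text \<open>
  Write a vector of \<open>V \<oplus> W\<close> as \<open>x = (v, F u)\<close>, which is possible because \<open>F\<close> is onto.  Subtracting
  \<open>\<alpha> x\<close> from \<open>T_F x\<close> leaves \<open>(u, F (\<gamma> v + (\<delta> - \<alpha>) u))\<close>, so \<open>L_x\<close> is generated by
  \<open>(v, F u)\<close> and \<open>(u, F (\<gamma> v + (\<delta> - \<alpha>) u))\<close>.  A transverse submodule is the graph of a linear map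
  \<open>G\<close>, and \<open>L_x\<close> is the graph of \<open>G\<close> precisely when \<open>v, u\<close> generate \<open>V\<close>, \<open>G v = F u\<close> and
  \<open>G u = F (\<gamma> v + (\<delta> - \<alpha>) u)\<close> (\<open>L_sub_eq_graph_of_iff\<close>).

  Two generators of a free module of rank two form a basis: the matrix \<open>P\<close> whose columns are their
  coordinates is surjective, hence invertible by a determinant argument
  (\<open>invertible_2_iff_surj\<close>).  In the basis \<open>v, u\<close> the two equations say that \<open>F\<^sup>-\<^sup>1 G\<close> has matrix
  \<open>C\<close>; in the given basis of \<open>V\<close> its matrix is therefore \<open>P C P\<^sup>-\<^sup>1\<close>.  As \<open>v, u\<close> range
  over all bases, all of \<open>F Orb(C)\<close> is reached (\<open>matrix_wrt_in_translate_Orb_iff\<close>).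

  A transverse submodule and its graph map determine each other, so the families of submodules
  of \<open>F\<close> and \<open>F'\<close> coincide if and only if \<open>F Orb(C) = F' Orb(C)\<close>.  This says that \<open>F\<^sup>-\<^sup>1 F'\<close>
  stabilises \<open>Orb(C)\<close>, that is, \<open>F\<close> and \<open>F'\<close> lie in the same left coset of the stabiliser
  \<open>\<Gamma>\<^sub>C\<close> (\<open>translate_Orb_eq_iff_translate_Gamma_stab_eq\<close>).
\<close>

section \<open>Invertible matrices of size two\<close>

lemma matrix_eq_2_iff:
  fixes A B :: "'a::comm_ring_1 ^ 2 ^ 2"
  shows "A = B \<longleftrightarrow> A *v axis 1 1 = B *v axis 1 1 \<and> A *v axis 2 1 = B *v axis 2 1"
  by (auto simp: vec_eq_iff forall_2 matrix_vector_mult_def sum_2 axis_def)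

lemma matrix_vector_mult_scale:
  fixes A :: "'a::comm_ring_1 ^ 'n ^ 'm"
  shows "A *v (c *s x) = c *s (A *v x)"
  by (simp add: vec_eq_iff matrix_vector_mult_def sum_distrib_left mult_ac)

lemma columns_2:
  obtains P :: "'a::comm_ring_1 ^ 2 ^ 2" where "P *v axis 1 1 = x" "P *v axis 2 1 = y"
proof
  let ?P = "(\<chi> i j. if j = 1 then x $ i else y $ i) :: 'a ^ 2 ^ 2"
  show "?P *v axis 1 1 = x" "?P *v axis 2 1 = y"
    by (auto simp: vec_eq_iff forall_2 matrix_vector_mult_def sum_2 axis_def)
qed

text \<open>
  Over a field this would follow by counting dimensions.  Over a commutative ring, multiplying
  \<open>P Q = 1\<close> on the left by the adjugate \<open>A\<close> of \<open>P\<close> identifies \<open>det P \<cdot> Q\<close> with \<open>A\<close>, so that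
  \<open>det P \<cdot> Q P = A P = det P\<close>; the scalar \<open>det P\<close> is a unit with inverse \<open>det Q\<close> and cancels.
\<close>
lemma right_inverse_imp_left_inverse_2:
  fixes P Q :: "'a::comm_ring_1 ^ 2 ^ 2"
  assumes "P ** Q = mat 1"
  shows "Q ** P = mat 1"
proof -
  define A :: "'a ^ 2 ^ 2" where
    "A = vector [vector [P $ 2 $ 2, - P $ 1 $ 2], vector [- P $ 2 $ 1, P $ 1 $ 1]]"
  have AP: "A ** P = mat (det P)"
    by (simp add: vec_eq_iff forall_2 matrix_matrix_mult_def sum_2 mat_def A_def det_2
        algebra_simps)
  have dets: "det Q * det P = 1"
    using assms det_mul[of P Q] by (simp add: mult.commute)
  have scalar: "mat c ** X = (\<chi> i j. c * X $ i $ j)" for c and X :: "'a ^ 2 ^ 2"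
    by (simp add: vec_eq_iff forall_2 matrix_matrix_mult_def sum_2 mat_def)
  have "mat (det P) ** Q = A"
    by (metis AP assms matrix_mul_assoc matrix_mul_rid)
  then have "mat (det P) ** (Q ** P) = mat (det P)"
    by (simp add: AP matrix_mul_assoc)
  then have "det P * (Q ** P) $ i $ j = (mat (det P) :: 'a ^ 2 ^ 2) $ i $ j" for i j
    unfolding scalar by (simp add: vec_eq_iff)
  then have "det Q * (det P * (Q ** P) $ i $ j) = det Q * (mat (det P) :: 'a ^ 2 ^ 2) $ i $ j"
    for i j by simp
  then have "(Q ** P) $ i $ j = (mat 1 :: 'a ^ 2 ^ 2) $ i $ j" for i j
    by (simp add: mult.assoc[symmetric] dets mat_def split: if_splits)
  then show ?thesis
    by (simp add: vec_eq_iff)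
qed

lemma invertible_2_iff_surj:
  fixes P :: "'a::comm_ring_1 ^ 2 ^ 2"
  shows "invertible P \<longleftrightarrow> surj ((*v) P)"
proof
  assume "invertible P"
  then obtain Q where "P ** Q = mat 1"
    by (auto simp: invertible_def)
  then have "P *v (Q *v x) = x" for x
    by (simp add: matrix_vector_mul_assoc)
  then show "surj ((*v) P)"
    by (metis surjI)
next
  assume surj: "surj ((*v) P)"
  then obtain x y where xy: "P *v x = axis 1 1" "P *v y = axis 2 1"
    by (metis surjD)
  obtain Q :: "'a ^ 2 ^ 2" where "Q *v axis 1 1 = x" "Q *v axis 2 1 = y"
    using columns_2 .
  with xy have "P ** Q = mat 1"
    by (simp add: matrix_eq_2_iff matrix_vector_mul_assoc[symmetric])
  then show "invertible P"
    using right_inverse_imp_left_inverse_2 by (auto simp: invertible_def)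
qed

lemma invertible_matrix_inv:
  fixes P :: "'a::comm_ring_1 ^ 2 ^ 2"
  assumes "invertible P"
  shows "P ** matrix_inv P = mat 1" "matrix_inv P ** P = mat 1" "invertible (matrix_inv P)"
proof -
  show *: "P ** matrix_inv P = mat 1" "matrix_inv P ** P = mat 1"
    using someI_ex[OF assms[unfolded invertible_def]] by (auto simp: matrix_inv_def)
  then show "invertible (matrix_inv P)"
    by (auto simp: invertible_def)
qed

text \<open>
  Conjugation is turned into an intertwining relation, which can be tested column by column.
\<close>
lemma in_translate_Orb_iff:
  fixes C M A :: "'a::comm_ring_1 ^ 2 ^ 2"
  shows "A \<in> translate M (Orb C) \<longleftrightarrow> (\<exists>P. invertible P \<and> A ** P = M ** (P ** C))"
proof
  assume "A \<in> translate M (Orb C)"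
  then obtain P where P: "invertible P" "A = M ** (P ** C ** matrix_inv P)"
    by (auto simp: translate_def Orb_def GL2_def)
  then have "A ** P = M ** (P ** C)"
    by (simp add: matrix_mul_assoc[symmetric] invertible_matrix_inv)
  with P show "\<exists>P. invertible P \<and> A ** P = M ** (P ** C)" by blast
next
  assume "\<exists>P. invertible P \<and> A ** P = M ** (P ** C)"
  then obtain P where P: "invertible P" "A ** P = M ** (P ** C)" by blast
  have "A = A ** P ** matrix_inv P"
    by (simp add: matrix_mul_assoc[symmetric] invertible_matrix_inv P(1))
  also have "\<dots> = M ** (P ** C ** matrix_inv P)"
    by (simp only: P(2) matrix_mul_assoc)
  finally have "A = M ** (P ** C ** matrix_inv P)" .
  with P show "A \<in> translate M (Orb C)"
    by (auto simp: translate_def Orb_def GL2_def)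
qed

section \<open>The stabiliser of an orbit\<close>

lemma translate_eq_image: "translate M S = (**) M ` S"
  by (auto simp: translate_def)

lemma translate_translate: "translate A (translate B S) = translate (A ** B) S"
  by (simp add: translate_eq_image image_image matrix_mul_assoc)

lemma translate_mat_1 [simp]: "translate (mat 1) S = S"
  by (simp add: translate_eq_image)

text \<open>
  The stabiliser is a group, so multiplication by one of its elements permutes it: it is closed
  under multiplication by \<open>H\<close> and by \<open>H\<^sup>-\<^sup>1\<close>.
\<close>
lemma translate_Gamma_stab:
  fixes C :: "'a::comm_ring_1 ^ 2 ^ 2"
  assumes "H \<in> Gamma_stab C"
  shows "translate H (Gamma_stab C) = Gamma_stab C"
proof -
  have H: "invertible H" "translate H (Orb C) = Orb C"
    using assms by (auto simp: Gamma_stab_def GL2_def)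
  note inv = invertible_matrix_inv[OF H(1)]
  have closed: "translate K (Gamma_stab C) \<subseteq> Gamma_stab C"
    if K: "invertible K" "translate K (Orb C) = Orb C" for K
  proof
    fix A assume "A \<in> translate K (Gamma_stab C)"
    then obtain J where "J \<in> Gamma_stab C" and J: "A = K ** J"
      unfolding translate_eq_image by blast
    then have J': "invertible J" "translate J (Orb C) = Orb C"
      by (simp_all add: Gamma_stab_def GL2_def)
    have "translate A (Orb C) = translate K (translate J (Orb C))"
      by (simp only: J translate_translate)
    then have "translate A (Orb C) = Orb C"
      by (simp only: J' K)
    with J J' K show "A \<in> Gamma_stab C"
      by (simp add: Gamma_stab_def GL2_def invertible_mult)
  qed
  have "translate (matrix_inv H) (Orb C) = Orb C"
    using arg_cong[OF H(2), of "translate (matrix_inv H)"] by (simp add: translate_translate inv(2))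
  then have "translate (matrix_inv H) (Gamma_stab C) \<subseteq> Gamma_stab C"
    using closed inv(3) by blast
  then have "translate H (translate (matrix_inv H) (Gamma_stab C)) \<subseteq> translate H (Gamma_stab C)"
    by (simp add: translate_eq_image image_mono)
  then show ?thesis
    using closed[OF H] by (simp add: translate_translate inv(1))
qed

text \<open>
  Both equations say that \<open>H = M\<^sup>-\<^sup>1 M'\<close> belongs to the stabiliser.
\<close>
lemma translate_Orb_eq_iff_translate_Gamma_stab_eq:
  fixes M M' C :: "'a::comm_ring_1 ^ 2 ^ 2"
  assumes M: "invertible M" and M': "invertible M'"
  shows "translate M (Orb C) = translate M' (Orb C)
    \<longleftrightarrow> translate M (Gamma_stab C) = translate M' (Gamma_stab C)"
proof -
  note inv = invertible_matrix_inv[OF M]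
  define H where "H = matrix_inv M ** M'"
  have M'_eq: "M' = M ** H"
    by (simp add: H_def matrix_mul_assoc inv)
  have "invertible H"
    by (simp add: H_def inv M' invertible_mult)
  have cancel: "translate M S = translate M T \<longleftrightarrow> S = T" for S T
    by (metis inv(2) translate_mat_1 translate_translate)
  have "translate M (Orb C) = translate M' (Orb C) \<longleftrightarrow> H \<in> Gamma_stab C"
    using \<open>invertible H\<close>
    by (auto simp: M'_eq translate_translate[symmetric] cancel Gamma_stab_def GL2_def)
  also have "\<dots> \<longleftrightarrow> translate H (Gamma_stab C) = Gamma_stab C"
  proof
    assume stable: "translate H (Gamma_stab C) = Gamma_stab C"
    have "mat 1 \<in> Gamma_stab C"
      by (auto simp: Gamma_stab_def GL2_def invertible_def intro!: exI[of _ "mat 1"])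
    then have "H ** mat 1 \<in> translate H (Gamma_stab C)"
      unfolding translate_eq_image by (rule imageI)
    with stable show "H \<in> Gamma_stab C" by simp
  qed (rule translate_Gamma_stab)
  also have "\<dots> \<longleftrightarrow> translate M (Gamma_stab C) = translate M' (Gamma_stab C)"
    by (auto simp: M'_eq translate_translate[symmetric] cancel)
  finally show ?thesis .
qed

section \<open>Coordinates and matrices\<close>

definition lincomb :: "('a::comm_ring_1 \<Rightarrow> 'v::ab_group_add \<Rightarrow> 'v) \<Rightarrow> ('n::finite \<Rightarrow> 'v) \<Rightarrow> 'a ^ 'n \<Rightarrow> 'v"
  where "lincomb s b x = (\<Sum>j\<in>UNIV. s (x $ j) (b j))"

lemma lincomb_add:
  assumes "module s"
  shows "lincomb s b (x + y) = lincomb s b x + lincomb s b y"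
  by (simp add: lincomb_def module.scale_left_distrib[OF assms] sum.distrib)

lemma lincomb_scale:
  assumes "module s"
  shows "lincomb s b (r *s x) = s r (lincomb s b x)"
  by (simp add: lincomb_def module.scale_sum_right[OF assms] module.scale_scale[OF assms])

lemma lincomb_representation:
  assumes "indexed_basis s b"
  shows "lincomb s b (\<chi> i. module.representation s (range b) v (b i)) = v"
proof -
  interpret module s using assms by (simp add: indexed_basis_def)
  have "(\<Sum>j\<in>UNIV. s (representation (range b) v (b j)) (b j))
      = (\<Sum>w\<in>range b. s (representation (range b) v w) w)"
    using assms by (simp add: sum.reindex indexed_basis_def)
  also have "\<dots> = v"
    using assms by (intro sum_representation_eq) (auto simp: indexed_basis_def)
  finally show ?thesis by (simp add: lincomb_def)
qed

lemma bij_lincomb: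
  assumes "indexed_basis s b"
  shows "bij (lincomb s b)"
proof (rule bijI)
  interpret module s using assms by (simp add: indexed_basis_def)
  have b: "inj b" "independent (range b)"
    using assms by (auto simp: indexed_basis_def)
  show "surj (lincomb s b)"
    unfolding surj_def by (blast intro: lincomb_representation[OF assms, symmetric])
  show "inj (lincomb s b)"
  proof (rule injI)
    fix x y assume "lincomb s b x = lincomb s b y"
    then have "0 = (\<Sum>j\<in>UNIV. s (x $ j - y $ j) (b j))"
      by (simp add: lincomb_def scale_left_diff_distrib sum_subtractf)
    also have "\<dots> = (\<Sum>w\<in>range b. s (x $ inv b w - y $ inv b w) w)"
      using b by (simp add: sum.reindex)
    finally have "x $ inv b (b i) - y $ inv b (b i) = 0" for i
      using independentD[OF b(2), of "range b" "\<lambda>w. x $ inv b w - y $ inv b w" "b i"] by simp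
    then show "x = y"
      using b by (simp add: vec_eq_iff)
  qed
qed

lemma lincomb_cases:
  assumes "indexed_basis s b"
  obtains x where "v = lincomb s b x"
  by (rule that[OF lincomb_representation[OF assms, symmetric]])

lemma lincomb_eq_iff:
  assumes "indexed_basis s b"
  shows "lincomb s b x = lincomb s b y \<longleftrightarrow> x = y"
  by (rule inj_eq[OF bij_is_inj[OF bij_lincomb[OF assms]]])

lemma hom_lincomb:
  assumes c: "indexed_basis t c" and f: "module_hom s t f"
  shows "f (lincomb s b x) = lincomb t c (matrix_wrt b t c f *v x)"
proof -
  interpret module_hom s t f by fact
  have "f (lincomb s b x) = (\<Sum>j\<in>UNIV. t (x $ j) (f (b j)))"
    by (simp add: lincomb_def sum scale)
  also have "\<dots> = (\<Sum>j\<in>UNIV. t (x $ j) (lincomb t c (\<chi> i. matrix_wrt b t c f $ i $ j)))"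
    using lincomb_representation[OF c] by (simp add: matrix_wrt_def)
  also have "\<dots> = (\<Sum>j\<in>UNIV. \<Sum>i\<in>UNIV. t (x $ j * matrix_wrt b t c f $ i $ j) (c i))"
    by (simp add: lincomb_def m2.scale_sum_right)
  also have "\<dots> = (\<Sum>i\<in>UNIV. \<Sum>j\<in>UNIV. t (x $ j * matrix_wrt b t c f $ i $ j) (c i))"
    by (rule sum.swap)
  also have "\<dots> = lincomb t c (matrix_wrt b t c f *v x)"
    by (simp add: lincomb_def matrix_vector_mult_def m2.scale_sum_left mult.commute)
  finally show ?thesis .
qed

lemma matrix_wrt_unique:
  assumes c: "indexed_basis t c" and f: "module_hom s t f"
    and A: "\<And>x. f (lincomb s b x) = lincomb t c (A *v x)"
  shows "matrix_wrt b t c f = A"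
  using A by (simp add: matrix_eq hom_lincomb[OF c f] lincomb_eq_iff[OF c])

lemma ex_hom_matrix_wrt:
  assumes b: "indexed_basis s b" and c: "indexed_basis t c"
  obtains f where "module_hom s t f" "matrix_wrt b t c f = A"
proof -
  have s: "module s" and t: "module t"
    using b c by (auto simp: indexed_basis_def)
  define f where "f = (\<lambda>v. lincomb t c (A *v inv (lincomb s b) v))"
  have inv: "inv (lincomb s b) (lincomb s b x) = x" for x
    using bij_lincomb[OF b] by (simp add: bij_is_inj)
  have f: "f (lincomb s b x) = lincomb t c (A *v x)" for x
    by (simp add: f_def inv)
  have "module_hom s t f"
    unfolding module_hom_iff
  proof (intro conjI allI s t)
    fix v w r
    obtain x y where "v = lincomb s b x" "w = lincomb s b y"
      by (rule lincomb_cases[OF b, of v], rule lincomb_cases[OF b, of w])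
    then show "f (v + w) = f v + f w" "f (s r v) = t r (f v)"
      by (simp_all add: lincomb_add[OF s, symmetric] lincomb_scale[OF s, symmetric] f
          lincomb_add[OF t, symmetric] lincomb_scale[OF t, symmetric]
          matrix_vector_right_distrib matrix_vector_mult_scale)
  qed
  with matrix_wrt_unique[OF c _ f] that show thesis by blast
qed

lemma invertible_matrix_wrt:
  fixes bV :: "2 \<Rightarrow> 'v::ab_group_add"
  assumes b: "indexed_basis s bV" and c: "indexed_basis t bW"
    and F: "module_isomorphism s t F"
  shows "invertible (matrix_wrt bV t (bW :: 2 \<Rightarrow> _) F)"
  unfolding invertible_2_iff_surj
proof (rule surjI)
  have hom: "module_hom s t F" and bij: "bij F"
    using F by (auto simp: module_isomorphism_def)
  fix y :: "'a ^ 2"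
  show "matrix_wrt bV t bW F *v inv (lincomb s bV) (inv F (lincomb t bW y)) = y"
    using hom_lincomb[OF c hom, of bV "inv (lincomb s bV) (inv F (lincomb t bW y))"]
      bij_lincomb[OF b] bij lincomb_eq_iff[OF c]
    by (simp add: bij_is_surj surj_f_inv_f)
qed

section \<open>Graphs and transverse submodules\<close>

definition graph_of :: "('v \<Rightarrow> 'w) \<Rightarrow> ('v \<times> 'w) set"
  where "graph_of G = range (\<lambda>v. (v, G v))"

lemma mem_graph_of [simp]: "(v, w) \<in> graph_of G \<longleftrightarrow> w = G v"
  by (auto simp: graph_of_def)

lemma graph_map_graph_of [simp]: "graph_map (graph_of G) = G"
proof
  fix v
  have "inv_into (graph_of G) fst v = (v, G v)"
    by (rule inv_into_f_eq) (auto simp: graph_of_def inj_on_def)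
  then show "graph_map (graph_of G) v = G v"
    by (simp add: graph_map_def)
qed

lemma inj_graph_of: "inj graph_of"
  by (rule inj_on_inverseI[of _ graph_map]) simp

lemma module_prodI: "module s \<Longrightarrow> module t \<Longrightarrow> module_prod s t"
  by (simp add: module_prod_def module_pair_def)

lemma subspace_graph_of:
  assumes "module_hom s t G"
  shows "module.subspace (module_prod.scale s t) (graph_of G)"
proof -
  interpret module_hom s t G by fact
  interpret module_prod s t by unfold_locales
  show ?thesis
    by (rule p.subspaceI) (auto simp: zero_prod_def scale_def add scale)
qed

text \<open>
  If every \<open>v\<close> has exactly one \<open>w\<close> with \<open>(v, w) \<in> L\<close>, then \<open>L\<close> is the graph of \<open>v \<mapsto> w\<close>, and closure of
  \<open>L\<close> under the module operations is linearity of this map.  Families of transverse submodules can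
  thus be replaced by families of linear maps.
\<close>
lemma V_transverse_iff_graph_of:
  assumes s: "module s" and t: "module t"
  shows "V_transverse s t L \<longleftrightarrow> (\<exists>G. module_hom s t G \<and> L = graph_of G)"
proof
  interpret module_prod s t by (rule module_prodI[OF s t])
  assume L: "V_transverse s t L"
  then have sub: "p.subspace L" and bij: "bij_betw fst L UNIV"
    by (auto simp: V_transverse_def)
  have "\<exists>w. (v, w) \<in> L" for v
  proof -
    have "v \<in> fst ` L"
      using bij by (simp add: bij_betw_def)
    then show ?thesis by auto
  qed
  then obtain G where G: "\<And>v. (v, G v) \<in> L"
    by metis
  have eq: "w = G v" if "(v, w) \<in> L" for v w
    using inj_onD[OF bij_betw_imp_inj_on[OF bij] _ that G] by simp
  have "module_hom s t G"
    unfolding module_hom_iff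
  proof (intro conjI allI s t)
    fix v w r
    have "(v + w, G v + G w) \<in> L"
      using p.subspace_add[OF sub G[of v] G[of w]] by simp
    then show "G (v + w) = G v + G w"
      by (rule eq[symmetric])
    have "(s r v, t r (G v)) \<in> L"
      using p.subspace_scale[OF sub G[of v], of r] by (simp add: scale_def)
    then show "G (s r v) = t r (G v)"
      by (rule eq[symmetric])
  qed
  moreover have "L = graph_of G"
    using G eq by auto
  ultimately show "\<exists>G. module_hom s t G \<and> L = graph_of G" by blast
next
  assume "\<exists>G. module_hom s t G \<and> L = graph_of G"
  then show "V_transverse s t L"
    by (auto simp: V_transverse_def subspace_graph_of)
      (auto simp: graph_of_def bij_betw_def inj_on_def image_iff)
qed

section \<open>The submodules generated by a vector and its image\<close>

text \<open>
  The two equations state that the generators of \<open>L_x\<close> lie on the graph, i.e. that \<open>L_x\<close> is contained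
  in it.  Since the graph contains a single point over each element of \<open>V\<close>, the inclusion is an
  equality exactly when \<open>L_x\<close> projects onto \<open>V\<close>; its projection is generated by \<open>v\<close> and \<open>u\<close>.
\<close>
lemma L_sub_eq_graph_of_iff:
  assumes F: "module_isomorphism s t F" and G: "module_hom s t G"
  shows "L_sub s t \<alpha> \<gamma> \<delta> F (v, F u) = graph_of G
    \<longleftrightarrow> module.span s {v, u} = UNIV \<and> G v = F u \<and> G u = F (s \<gamma> v + s (\<delta> - \<alpha>) u)"
proof -
  have homF: "module_hom s t F" and bijF: "bij F"
    using F by (auto simp: module_isomorphism_def)
  interpret F: module_hom s t F by fact
  interpret G: module_hom s t G by fact
  interpret module_prod s t by unfold_locales
  let ?x = "(v, F u)"
  \<comment> \<open>\<open>?y\<close> is \<open>T_F x - \<alpha> x\<close>; it replaces \<open>T_F x\<close> as a generator.\<close>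
  let ?y = "(u, F (s \<gamma> v + s (\<delta> - \<alpha>) u))"
  let ?Tx = "T_op s t \<alpha> \<gamma> \<delta> F ?x"
  have y: "?Tx = ?y + scale \<alpha> ?x"
    using bijF
    by (simp add: T_op_def scale_def F.add F.scale bij_is_inj F.m2.scale_left_diff_distrib
        F.m1.scale_left_diff_distrib F.diff algebra_simps)
  have "?x \<in> p.span {?x, ?y}" "?y \<in> p.span {?x, ?y}"
    by (simp_all add: p.span_base)
  then have "?Tx \<in> p.span {?x, ?y}"
    unfolding y by (intro p.span_add p.span_scale)
  moreover have "?x \<in> p.span {?x, ?Tx}" "?Tx \<in> p.span {?x, ?Tx}"
    by (simp_all add: p.span_base)
  then have "?Tx - scale \<alpha> ?x \<in> p.span {?x, ?Tx}"
    by (intro p.span_diff p.span_scale)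
  then have "?y \<in> p.span {?x, ?Tx}"
    by (simp only: y add_diff_cancel_right')
  ultimately have L: "L_sub s t \<alpha> \<gamma> \<delta> F ?x = p.span {?x, ?y}"
    unfolding L_sub_def p.span_eq by (simp add: p.span_base)
  interpret fst: module_hom scale s fst
    by unfold_locales (auto simp: scale_def)
  have fst_L: "fst ` p.span {?x, ?y} = F.m1.span {v, u}"
    using fst.span_image[of "{?x, ?y}"] by simp
  show ?thesis
    unfolding L
  proof safe
    assume eq: "p.span {?x, ?y} = graph_of G"
    have "?x \<in> graph_of G" "?y \<in> graph_of G"
      unfolding eq[symmetric] by (auto intro: p.span_base)
    then show "G v = F u" "G u = F (s \<gamma> v + s (\<delta> - \<alpha>) u)" by auto
    show "w \<in> F.m1.span {v, u}" for w
      unfolding fst_L[symmetric] eq by (force simp: graph_of_def)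
  next
    assume span: "F.m1.span {v, u} = UNIV"
      and Gv: "G v = F u" and Gu: "G u = F (s \<gamma> v + s (\<delta> - \<alpha>) u)"
    have sub: "p.span {?x, ?y} \<subseteq> graph_of G"
      by (rule p.span_minimal) (auto simp: Gv Gu subspace_graph_of[OF G])
    then show "z \<in> graph_of G" if "z \<in> p.span {?x, ?y}" for z
      using that by blast
    show "z \<in> p.span {?x, ?y}" if "z \<in> graph_of G" for z
    proof -
      have "fst z \<in> fst ` p.span {?x, ?y}"
        by (simp add: fst_L span)
      then obtain z' where z': "z' \<in> p.span {?x, ?y}" "fst z' = fst z" by auto
      with sub that have "z' = z"
        by (auto simp: graph_of_def)
      with z' show ?thesis by simp
    qed
  qed auto
qed

text \<open>
  The span is the image of the column space of \<open>P\<close> under the coordinate isomorphism, so it is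
  everything exactly when \<open>P\<close> is surjective.
\<close>
lemma span_lincomb_columns_iff_invertible:
  fixes b :: "2 \<Rightarrow> 'v::ab_group_add" and P :: "'a::comm_ring_1 ^ 2 ^ 2"
  assumes b: "indexed_basis s b"
  shows "module.span s {lincomb s b (P *v axis 1 1), lincomb s b (P *v axis 2 1)} = UNIV
    \<longleftrightarrow> invertible P"
proof -
  interpret module s using b by (simp add: indexed_basis_def)
  let ?v = "lincomb s b (P *v axis 1 1)" and ?u = "lincomb s b (P *v axis 2 1)"
  have comb: "lincomb s b (P *v z) = s (z $ 1) ?v + s (z $ 2) ?u" for z
  proof -
    have z: "z = z $ 1 *s axis 1 1 + z $ 2 *s axis 2 1"
      by (simp add: vec_eq_iff forall_2 axis_def)
    have "lincomb s b (P *v z) = lincomb s b (P *v (z $ 1 *s axis 1 1 + z $ 2 *s axis 2 1))"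
      by (rule arg_cong[OF z])
    also have "\<dots> = s (z $ 1) ?v + s (z $ 2) ?u"
      by (simp only: matrix_vector_right_distrib matrix_vector_mult_scale
          lincomb_add[OF module_axioms] lincomb_scale[OF module_axioms])
    finally show ?thesis .
  qed
  have "span {?v, ?u} = range (\<lambda>z. lincomb s b (P *v z))"
  proof safe
    fix w assume "w \<in> span {?v, ?u}"
    then obtain k l where "w - s k ?v - s l ?u = 0"
      by (auto simp: span_breakdown_eq)
    then have "w = s k ?v + s l ?u"
      by (simp add: diff_diff_eq)
    then have "w = lincomb s b (P *v vector [k, l])"
      by (simp only: comb[of "vector [k, l]"] vector_2)
    then show "w \<in> range (\<lambda>z. lincomb s b (P *v z))" by blast
  next
    fix z show "lincomb s b (P *v z) \<in> span {?v, ?u}"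
      unfolding comb[of z] by (intro span_add span_scale span_base) auto
  qed
  also have "\<dots> = lincomb s b ` range ((*v) P)"
    by auto
  finally have "span {?v, ?u} = UNIV \<longleftrightarrow> lincomb s b ` range ((*v) P) = lincomb s b ` UNIV"
    using bij_lincomb[OF b] by (simp add: bij_is_surj)
  also have "\<dots> \<longleftrightarrow> surj ((*v) P)"
    using bij_lincomb[OF b] by (intro inj_image_eq_iff) (rule bij_is_inj)
  finally show ?thesis
    by (simp add: invertible_2_iff_surj)
qed

text \<open>
  The matrix \<open>P\<close> conjugating \<open>C\<close> is the change of basis from the given basis to \<open>v, u\<close>.  The columns
  of \<open>C\<close> express that \<open>F\<^sup>-\<^sup>1 G\<close> sends \<open>v\<close> to \<open>u\<close> and \<open>u\<close> to \<open>\<gamma> v + (\<delta> - \<alpha>) u\<close>.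
\<close>
lemma matrix_wrt_in_translate_Orb_iff:
  fixes bV :: "2 \<Rightarrow> 'v::ab_group_add" and bW :: "2 \<Rightarrow> 'w::ab_group_add"
  assumes bV: "indexed_basis s bV" and bW: "indexed_basis t bW"
    and F: "module_hom s t F" and G: "module_hom s t G"
  shows "matrix_wrt bV t bW G \<in> translate (matrix_wrt bV t bW F) (Orb (C_mat \<alpha> \<gamma> \<delta>))
    \<longleftrightarrow> (\<exists>v u. module.span s {v, u} = UNIV \<and> G v = F u \<and> G u = F (s \<gamma> v + s (\<delta> - \<alpha>) u))"
    (is "?A \<in> translate ?M (Orb ?C) \<longleftrightarrow> _")
proof -
  have s: "module s"
    using bV by (simp add: indexed_basis_def)
  let ?e = "\<lambda>j::2. axis j (1::'a)"
  let ?p = "\<lambda>P j. lincomb s bV (P *v ?e j)"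
  have C: "?C *v ?e 1 = ?e 2" "?C *v ?e 2 = \<gamma> *s ?e 1 + (\<delta> - \<alpha>) *s ?e 2"
    by (simp_all add: C_mat_def vec_eq_iff forall_2 matrix_vector_mult_def sum_2 axis_def)
  have step: "?A ** P = ?M ** (P ** ?C)
      \<longleftrightarrow> G (?p P 1) = F (?p P 2) \<and> G (?p P 2) = F (s \<gamma> (?p P 1) + s (\<delta> - \<alpha>) (?p P 2))" for P
  proof -
    have "s \<gamma> (?p P 1) + s (\<delta> - \<alpha>) (?p P 2) = lincomb s bV (P *v (?C *v ?e 2))"
      by (simp only: C lincomb_add[OF s] lincomb_scale[OF s] matrix_vector_right_distrib
          matrix_vector_mult_scale)
    then show ?thesis
      by (simp add: matrix_eq_2_iff matrix_vector_mul_assoc[symmetric] C(1)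
          hom_lincomb[OF bW F] hom_lincomb[OF bW G] lincomb_eq_iff[OF bW])
  qed
  have all: "(\<exists>P. Q (?p P 1) (?p P 2)) \<longleftrightarrow> (\<exists>v u. Q v u)" for Q
  proof
    assume "\<exists>v u. Q v u"
    then obtain v u where "Q v u" by blast
    moreover obtain x where "v = lincomb s bV x" by (rule lincomb_cases[OF bV])
    moreover obtain y where "u = lincomb s bV y" by (rule lincomb_cases[OF bV])
    moreover obtain P where "P *v ?e 1 = x" "P *v ?e 2 = y" by (rule columns_2)
    ultimately show "\<exists>P. Q (?p P 1) (?p P 2)" by blast
  qed blast
  show ?thesis
    unfolding in_translate_Orb_iff step span_lincomb_columns_iff_invertible[OF bV, symmetric]
    by (rule all)
qed

lemma admissible_submodules_eq_graphs:
  fixes bV :: "2 \<Rightarrow> 'v::ab_group_add" and bW :: "2 \<Rightarrow> 'w::ab_group_add"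
  assumes bV: "indexed_basis s bV" and bW: "indexed_basis t bW"
    and F: "module_isomorphism s t F"
  shows "{L_sub s t \<alpha> \<gamma> \<delta> F x | x. admissible s t \<alpha> \<gamma> \<delta> F x}
    = graph_of ` {G. module_hom s t G \<and>
        matrix_wrt bV t bW G \<in> translate (matrix_wrt bV t bW F) (Orb (C_mat \<alpha> \<gamma> \<delta>))}"
    (is "?Ls = graph_of ` ?Gs")
proof -
  have s: "module s" and t: "module t"
    using bV bW by (auto simp: indexed_basis_def)
  have homF: "module_hom s t F" and "bij F"
    using F by (auto simp: module_isomorphism_def)
  have in_Gs: "G \<in> ?Gs \<longleftrightarrow> module_hom s t G \<and> (\<exists>x. L_sub s t \<alpha> \<gamma> \<delta> F x = graph_of G)" for G
  proof -
    have "(\<exists>x. L_sub s t \<alpha> \<gamma> \<delta> F x = graph_of G)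
        \<longleftrightarrow> (\<exists>v u. L_sub s t \<alpha> \<gamma> \<delta> F (v, F u) = graph_of G)"
      using \<open>bij F\<close> by (metis bij_is_surj surjD surj_pair)
    then show ?thesis
      by (cases "module_hom s t G")
        (simp_all only: mem_Collect_eq matrix_wrt_in_translate_Orb_iff[OF bV bW homF]
          L_sub_eq_graph_of_iff[OF F] simp_thms)
  qed
  have "L \<in> ?Ls \<longleftrightarrow> L \<in> graph_of ` ?Gs" for L
  proof -
    have "L \<in> ?Ls \<longleftrightarrow> (\<exists>G. L = graph_of G \<and> module_hom s t G \<and> (\<exists>x. L_sub s t \<alpha> \<gamma> \<delta> F x = L))"
      unfolding admissible_def V_transverse_iff_graph_of[OF s t] mem_Collect_eq by metis
    also have "\<dots> \<longleftrightarrow> L \<in> graph_of ` ?Gs"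
      unfolding image_iff Bex_def in_Gs by metis
    finally show ?thesis .
  qed
  then show ?thesis by (rule set_eqI)
qed

theorem corollary5p4:
  fixes sV :: "'a::comm_ring_1 \<Rightarrow> 'v::ab_group_add \<Rightarrow> 'v"
    and sW :: "'a \<Rightarrow> 'w::ab_group_add \<Rightarrow> 'w"
    and bV :: "2 \<Rightarrow> 'v" and bW :: "2 \<Rightarrow> 'w"
    and \<alpha> \<gamma> \<delta> :: 'a
    and F :: "'v \<Rightarrow> 'w"
  assumes "indexed_basis sV bV" and "indexed_basis sW bW"
    and "module_isomorphism sV sW F"
  shows "{graph_map (L_sub sV sW \<alpha> \<gamma> \<delta> F x) | x. admissible sV sW \<alpha> \<gamma> \<delta> F x}
        = {G. module_hom sV sW G \<and>
              matrix_wrt bV sW bW G \<in> translate (matrix_wrt bV sW bW F) (Orb (C_mat \<alpha> \<gamma> \<delta>))}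
    \<and> ((2::'a) dvd 1 \<longrightarrow>
        (\<forall>F'. module_isomorphism sV sW F' \<longrightarrow>
          ({L_sub sV sW \<alpha> \<gamma> \<delta> F x | x. admissible sV sW \<alpha> \<gamma> \<delta> F x}
             = {L_sub sV sW \<alpha> \<gamma> \<delta> F' x | x. admissible sV sW \<alpha> \<gamma> \<delta> F' x}
           \<longleftrightarrow> translate (matrix_wrt bV sW bW F) (Gamma_stab (C_mat \<alpha> \<gamma> \<delta>))
             = translate (matrix_wrt bV sW bW F') (Gamma_stab (C_mat \<alpha> \<gamma> \<delta>)))))"
proof (intro conjI impI allI)
  note bV = assms(1) and bW = assms(2) and F = assms(3)
  let ?M = "matrix_wrt bV sW bW"
  let ?O = "Orb (C_mat \<alpha> \<gamma> \<delta>)" and ?\<Gamma> = "Gamma_stab (C_mat \<alpha> \<gamma> \<delta>)"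
  let ?Gs = "\<lambda>F. {G. module_hom sV sW G \<and> ?M G \<in> translate (?M F) ?O}"
  let ?Ls = "\<lambda>F. {L_sub sV sW \<alpha> \<gamma> \<delta> F x | x. admissible sV sW \<alpha> \<gamma> \<delta> F x}"
  note Ls = admissible_submodules_eq_graphs[OF bV bW]
  have "{graph_map (L_sub sV sW \<alpha> \<gamma> \<delta> F x) | x. admissible sV sW \<alpha> \<gamma> \<delta> F x} = graph_map ` ?Ls F"
    by blast
  also have "\<dots> = ?Gs F"
    unfolding Ls[OF F] by (simp add: image_image)
  finally show "{graph_map (L_sub sV sW \<alpha> \<gamma> \<delta> F x) | x. admissible sV sW \<alpha> \<gamma> \<delta> F x} = ?Gs F" .
  fix F' assume F': "module_isomorphism sV sW F'"
  \<comment> \<open>Every matrix comes from a linear map, so the graph maps determine the translated orbit.\<close>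
  have M_Gs: "?M ` ?Gs F = translate (?M F) ?O" for F
    using ex_hom_matrix_wrt[OF bV bW] by (auto simp: image_iff) metis
  have "?Ls F = ?Ls F' \<longleftrightarrow> ?Gs F = ?Gs F'"
    unfolding Ls[OF F] Ls[OF F'] by (rule inj_image_eq_iff[OF inj_graph_of])
  also have "\<dots> \<longleftrightarrow> translate (?M F) ?O = translate (?M F') ?O"
  proof
    assume "?Gs F = ?Gs F'"
    then have "?M ` ?Gs F = ?M ` ?Gs F'" by (rule arg_cong)
    then show "translate (?M F) ?O = translate (?M F') ?O" by (simp only: M_Gs)
  qed (simp only:)
  also have "\<dots> \<longleftrightarrow> translate (?M F) ?\<Gamma> = translate (?M F') ?\<Gamma>"
    by (intro translate_Orb_eq_iff_translate_Gamma_stab_eq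
        invertible_matrix_wrt[OF bV bW F] invertible_matrix_wrt[OF bV bW F'])
  finally show "?Ls F = ?Ls F' \<longleftrightarrow> translate (?M F) ?\<Gamma> = translate (?M F') ?\<Gamma>" .
qed

end
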